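(* For $0<\lambda<1/2$ let $K_\lambda\subset[0,1]$ be the unique nonempty compact set with $K_\lambda=\lambda K_\lambda\cup(\lambda K_\lambda+1-\lambda)$, and let $E_\lambda=(K_\lambda\times K_\lambda)\cap S^1$, where $S^1=\{(x,y)\in\mathbb{R}^2:x^2+y^2=1\}$. Then $$\frac{1}{\log 2}\le\liminf_{\lambda\uparrow1/2}\frac{1-\dim_{\mathrm H}E_\lambda}{1-2\lambda}\le\limsup_{\lambda\uparrow1/2}\frac{1-\dim_{\mathrm H}E_\lambda}{1-2\lambda}\le 1536\left(1+\frac{3\sqrt{39}}{5\sqrt{7}}\right).$$
   Context: $\dim_{\mathrm H}$ denotes Hausdorff dimension and $\log$ the natural logarithm. *)

theory Defs
  imports "HOL-Analysis.Analysis"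
begin

text \<open>
  The weight \<open>(diam U)\<^sup>s\<close> with the usual conventions: the empty set has weight \<open>0\<close>, and
  \<open>(diam U)\<^sup>0 = 1\<close> for nonempty \<open>U\<close>. The case \<open>s = 0\<close> is separate because
  \<open>0 powr 0 = 0\<close> in Isabelle.
\<close>

definition diam_weight :: "real \<Rightarrow> 'a::metric_space set \<Rightarrow> real" where
  "diam_weight s U = (if U = {} then 0 else if s = 0 then 1 else diameter U powr s)"

text \<open>
  Covers are restricted to bounded sets because \<^const>\<open>diameter\<close> is meaningless on unbounded
  ones. Finite covers are included, since \<open>U i\<close> may be empty. If there is no admissible
  cover, the infimum is \<open>\<infinity>\<close>.
\<close>

definition hausdorff_premeasure :: "real \<Rightarrow> real \<Rightarrow> 'a::metric_space set \<Rightarrow> ennreal" where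
  "hausdorff_premeasure s \<delta> A =
     (INF U \<in> {U :: nat \<Rightarrow> 'a set. A \<subseteq> (\<Union>i. U i) \<and> (\<forall>i. bounded (U i) \<and> diameter (U i) \<le> \<delta>)}.
        \<Sum>i. ennreal (diam_weight s (U i)))"

definition hausdorff_measure :: "real \<Rightarrow> 'a::metric_space set \<Rightarrow> ennreal" where
  "hausdorff_measure s A = (SUP \<delta> \<in> {0<..}. hausdorff_premeasure s \<delta> A)"

definition hausdorff_dim :: "'a::metric_space set \<Rightarrow> ereal" where
  "hausdorff_dim A = (INF s \<in> {s. 0 \<le> s \<and> hausdorff_measure s A = 0}. ereal s)"

definition cantor_equation :: "real \<Rightarrow> real set \<Rightarrow> bool" where
  "cantor_equation l K \<longleftrightarrow>
     K \<noteq> {} \<and> compact K \<and> K = (\<lambda>x. l * x) ` K \<union> (\<lambda>x. l * x + 1 - l) ` K"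

definition cantor_set :: "real \<Rightarrow> real set" where
  "cantor_set l = (THE K. cantor_equation l K)"

definition cantor_circle :: "real \<Rightarrow> (real \<times> real) set" where
  "cantor_circle l = (cantor_set l \<times> cantor_set l) \<inter> {(x, y). x\<^sup>2 + y\<^sup>2 = 1}"

text \<open>The definite description above is justified by existence and uniqueness.\<close>

lemma cantor_equation_subset:
  assumes l: "0 < l" "l < 1/2" and A: "cantor_equation l A" and B: "cantor_equation l B"
  shows "A \<subseteq> B"
proof -
  have A': "A \<noteq> {}" "compact A" "A = (\<lambda>x. l * x) ` A \<union> (\<lambda>x. l * x + 1 - l) ` A"
    and B': "B \<noteq> {}" "compact B" "B = (\<lambda>x. l * x) ` B \<union> (\<lambda>x. l * x + 1 - l) ` B"
    using A B unfolding cantor_equation_def by blast+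
  have "continuous_on A (\<lambda>x. infdist x B)"
    by (intro continuous_intros)
  then obtain x where x: "x \<in> A" "\<And>y. y \<in> A \<Longrightarrow> infdist y B \<le> infdist x B"
    using continuous_attains_sup[OF A'(2,1)] by blast
  have "x \<in> (\<lambda>x. l * x) ` A \<union> (\<lambda>x. l * x + 1 - l) ` A"
    using x(1) A'(3) by blast
  then obtain a c where a: "a \<in> A" "x = l * a + c" and c: "c = 0 \<or> c = 1 - l"
    by fastforce
  obtain b where b: "b \<in> B" "infdist a B = dist a b"
    using infdist_attains_inf[of B a] B' compact_imp_closed by blast
  have "l * b + c \<in> (\<lambda>x. l * x) ` B \<union> (\<lambda>x. l * x + 1 - l) ` B"
    using b(1) c by (auto simp: add_diff_eq)
  hence "l * b + c \<in> B" using B'(3) by blast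
  hence "infdist x B \<le> dist x (l * b + c)" by (rule infdist_le)
  also have "\<dots> = l * dist a b"
    using l by (simp add: a(2) dist_real_def abs_mult flip: right_diff_distrib)
  also have "\<dots> \<le> l * infdist x B"
    using x(2)[OF a(1)] b(2) l by simp
  finally have "(1 - l) * infdist x B \<le> 0" by (simp add: algebra_simps)
  hence "infdist x B \<le> 0" using l by (simp add: mult_le_0_iff)
  hence "infdist y B = 0" if "y \<in> A" for y
    using x(2)[OF that] infdist_nonneg[of y B] by linarith
  thus ?thesis
    using B' compact_imp_closed in_closed_iff_infdist_zero by blast
qed

lemma cantor_equation_exists:
  assumes l: "0 < l" "l < 1/2"
  shows "\<exists>K \<subseteq> {0..1}. cantor_equation l K"
proof -
  define f where "f = (\<lambda>x::real. l * x)"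
  define g where "g = (\<lambda>x::real. l * x + 1 - l)"
  define T where "T = (\<lambda>X. f ` X \<union> g ` X)"
  define C where "C = (\<lambda>n. (T ^^ n) {0..1})"
  define K where "K = (\<Inter>n. C n)"
  have C0: "C 0 = {0..1}" and CS: "C (Suc n) = T (C n)" for n
    by (simp_all add: C_def)
  have T1: "T {0..1} \<subseteq> {0..1}"
  proof -
    have "l * x \<le> 1" "l * x + 1 - l \<ge> 0" "l * x + 1 - l \<le> 1" "0 \<le> l * x"
      if "x \<in> {0..1}" for x
    proof -
      have "0 \<le> l * x" "l * x \<le> l" using that l by (auto simp: mult_left_le)
      thus "l * x \<le> 1" "l * x + 1 - l \<ge> 0" "l * x + 1 - l \<le> 1" "0 \<le> l * x"
        using l by linarith+
    qed
    thus ?thesis by (auto simp: T_def f_def g_def)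
  qed
  have mono: "T X \<subseteq> T Y" if "X \<subseteq> Y" for X Y
    using that by (auto simp: T_def)
  have dec: "C (Suc n) \<subseteq> C n" for n
  proof (induction n)
    case 0 thus ?case using T1 by (simp add: CS C0)
  next
    case (Suc n) thus ?case using mono CS by metis
  qed
  have C1: "C n \<subseteq> {0..1}" for n
    by (induction n) (use dec C0 in blast)+
  have cpt: "compact (C n)" for n
    by (induction n)
      (auto simp: C0 CS T_def f_def g_def intro!: compact_Un compact_continuous_image continuous_intros)
  have zero: "0 \<in> C n" for n
    by (induction n) (auto simp: C0 CS T_def f_def)
  have K1: "K \<subseteq> {0..1}" using C0 unfolding K_def by blast
  have Kc: "compact K" unfolding K_def using cpt by (intro compact_Inter) auto
  have "K \<noteq> {}" using zero by (auto simp: K_def)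
  moreover have "K \<subseteq> T K"
  proof
    fix x assume "x \<in> K"
    hence xT: "x \<in> T (C n)" for n unfolding K_def using CS by blast
    have "x \<in> f ` K \<or> x \<in> g ` K"
    proof (cases "x < 1/2")
      case True
      have "x / l \<in> C n" for n
      proof -
        have "x \<notin> g ` C n"
        proof
          assume "x \<in> g ` C n"
          then obtain y where y: "y \<in> C n" "x = l * y + 1 - l" by (auto simp: g_def)
          hence "0 \<le> l * y" using C1[of n] l by auto
          thus False using y True l by linarith
        qed
        thus ?thesis using xT[of n] l by (auto simp: T_def f_def)
      qed
      hence "x / l \<in> K" by (auto simp: K_def)
      moreover have "x = f (x / l)" using l by (simp add: f_def)
      ultimately show ?thesis by blast
    next
      case False
      have "(x - 1 + l) / l \<in> C n" for n
      proof -
        have "x \<notin> f ` C n"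
        proof
          assume "x \<in> f ` C n"
          then obtain y where y: "y \<in> C n" "x = l * y" by (auto simp: f_def)
          hence "y \<le> 1" using C1[of n] by auto
          hence "l * y \<le> l" using l by (simp add: mult_left_le)
          thus False using y False l by linarith
        qed
        thus ?thesis using xT[of n] l by (auto simp: T_def g_def)
      qed
      hence "(x - 1 + l) / l \<in> K" by (auto simp: K_def)
      moreover have "x = g ((x - 1 + l) / l)" using l by (simp add: g_def)
      ultimately show ?thesis by blast
    qed
    thus "x \<in> T K" by (auto simp: T_def)
  qed
  moreover have "T K \<subseteq> K"
  proof -
    have "T K \<subseteq> C n" for n
    proof -
      have "T K \<subseteq> T (C n)" by (rule mono) (auto simp: K_def)
      thus ?thesis using dec[of n] CS by blast
    qed
    thus ?thesis by (auto simp: K_def)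
  qed
  ultimately have "cantor_equation l K"
    using Kc unfolding cantor_equation_def T_def f_def g_def by blast
  thus ?thesis using K1 by blast
qed

lemma cantor_equation_ex1:
  assumes "0 < l" "l < 1/2"
  shows "\<exists>!K. cantor_equation l K"
  using cantor_equation_exists[OF assms] cantor_equation_subset[OF assms] by (meson subset_antisym)

lemma cantor_set:
  assumes "0 < l" "l < 1/2"
  shows "cantor_equation l (cantor_set l)" "cantor_set l \<subseteq> {0..1}"
proof -
  show *: "cantor_equation l (cantor_set l)"
    unfolding cantor_set_def by (rule theI'[OF cantor_equation_ex1[OF assms]])
  show "cantor_set l \<subseteq> {0..1}"
    using cantor_equation_exists[OF assms] cantor_equation_subset[OF assms *] by blast
qed

end

theory Submission
  imports Defs
begin

text \<open>
  Write \<open>e = 1 - 2l\<close>, \<open>K\<close> for the Cantor set and \<open>E\<close> for the intersection of \<open>K \<times> K\<close> with the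
  circle.

  The lower bound on \<open>1 - dim E\<close> is \<open>dim E \<le> dim K = ln 2 / ln (1/l)\<close>
  (\<open>hausdorff_dim_cantor_circle_le\<close>): either half of the quarter circle, cut at the diagonal, is
  a Lipschitz graph over one coordinate, so the \<open>2 ^ n\<close> intervals of length \<open>l ^ n\<close> covering \<open>K\<close>
  give \<open>2 \<cdot> 2 ^ n\<close> arcs of size \<open>O(l ^ n)\<close> covering \<open>E\<close>. The quotient in question is then at
  least \<open>1 / ln (1/l)\<close>, which tends to \<open>1 / ln 2\<close>.

  For the upper bound, \<open>E\<close> contains all points \<open>(x, f x)\<close>, \<open>f x = sqrt (1 - x\<^sup>2)\<close>, such that neither
  \<open>x\<close> nor \<open>f x\<close> lies in a gap of \<open>K\<close>. The gaps of level \<open>k\<close> have length \<open>e l ^ k\<close> and centres at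
  mutual distance at least \<open>l ^ k\<close>, so each level removes about a proportion \<open>e\<close> of the line.
  On \<open>[3/5, 4/5]\<close> the map \<open>f\<close> is bi-Lipschitz, and the preimages of the gaps behave in the same
  way up to constants. Divide an interval into \<open>N = 2 ^ m\<close> equal children with \<open>m\<close> about
  \<open>1 / (400 e)\<close>. Only about \<open>m\<close> levels have gap lengths between a fixed fraction of the child and
  the same fraction of the parent; together they spoil a proportion of order \<open>m e\<close> of the children
  plus a boundary term, and the constants are such that at least a tenth of the children survive
  (\<open>card_children_meeting_large_gaps\<close>). Iterating, one obtains a tree with at least \<open>N / 10\<close>
  children at each node and contraction ratio \<open>1 / N\<close>, whose limit set has dimension
  at least \<open>1 - ln 10 / ln N\<close>. The argument below loses a further factor \<open>3\<close> per generation and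
  gives \<open>s = 1 - ln 32 / ln N = 1 - 5 / m\<close>.

  The dimension of the tree is bounded from below without constructing a measure: given a
  countable family of sets \<open>V i\<close> with \<open>\<Sum>i. (diam (V i)) powr s\<close> small, one descends the tree, always
  into a child for which the sum over the \<open>V i\<close> meeting it is at most average, and arrives at a
  limit point that no \<open>V i\<close> contains (\<open>nested_intervals_escape\<close>). A family with a small sum thus
  never covers \<open>E\<close>, which is \<open>dim E \<ge> s\<close> by \<open>hausdorff_dim_ge\<close>.
  As \<open>5 / (m e) \<le> 3000\<close> for small \<open>e\<close>, the limit superior is at most \<open>3000\<close>, and
  \<open>3000 < 1536 \<cdot> 2\<close> is below the asserted bound because \<open>3 sqrt 39 \<ge> 5 sqrt 7\<close>.
\<close>

section \<open>Counting separated points and subintervals\<close>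

lemma card_separated_le:
  fixes A :: "real set"
  assumes s: "0 < s" and sep: "\<And>x y. x \<in> A \<Longrightarrow> y \<in> A \<Longrightarrow> x \<noteq> y \<Longrightarrow> s \<le> \<bar>x - y\<bar>"
    and bd: "\<And>x y. x \<in> A \<Longrightarrow> y \<in> A \<Longrightarrow> \<bar>x - y\<bar> \<le> D" and D: "0 \<le> D"
  shows "finite A \<and> real (card A) \<le> D / s + 1"
proof (cases "A = {}")
  case False
  then obtain b where b: "b \<in> A" by blast
  have below: "bdd_below A" by (rule bdd_belowI[of _ "b - D"]) (use bd b in force)
  define a where "a = Inf A"
  have lo: "a \<le> x" if "x \<in> A" for x unfolding a_def by (rule cInf_lower[OF that below])
  have hi: "x \<le> a + D" if "x \<in> A" for x
  proof -
    have "x - D \<le> a" unfolding a_def by (rule cInf_greatest[OF False]) (use bd that in force)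
    thus ?thesis by simp
  qed
  \<comment> \<open>a half-open cell of length \<open>s\<close> contains at most one point of \<open>A\<close>\<close>
  define f where "f = (\<lambda>x. nat \<lfloor>(x - a) / s\<rfloor>)"
  have inj: "inj_on f A"
  proof (rule inj_onI, rule ccontr)
    fix x y assume x: "x \<in> A" and y: "y \<in> A" and eq: "f x = f y" and ne: "x \<noteq> y"
    have "0 \<le> (x - a) / s" "0 \<le> (y - a) / s" using lo x y s by auto
    hence "0 \<le> \<lfloor>(x - a) / s\<rfloor>" "0 \<le> \<lfloor>(y - a) / s\<rfloor>" unfolding zero_le_floor .
    hence "\<lfloor>(x - a) / s\<rfloor> = \<lfloor>(y - a) / s\<rfloor>" using eq unfolding f_def by linarith
    hence "\<bar>(x - a) / s - (y - a) / s\<bar> < 1" by linarith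
    hence "\<bar>(x - y) / s\<bar> < 1" by (simp add: diff_divide_distrib)
    hence "\<bar>x - y\<bar> < s" using s by (simp add: abs_divide)
    thus False using sep[OF x y ne] by simp
  qed
  have sub: "f ` A \<subseteq> {..nat \<lfloor>D / s\<rfloor>}"
  proof
    fix k assume "k \<in> f ` A"
    then obtain x where x: "x \<in> A" "k = f x" by blast
    have "(x - a) / s \<le> D / s" using hi[OF x(1)] s by (intro divide_right_mono) auto
    thus "k \<in> {..nat \<lfloor>D / s\<rfloor>}" using x by (simp add: f_def nat_mono floor_mono)
  qed
  have fin: "finite A" using inj sub by (metis finite_atMost finite_imageD finite_subset)
  have "card A \<le> card {..nat \<lfloor>D / s\<rfloor>}" by (rule card_inj_on_le[OF inj sub]) simp
  hence "real (card A) \<le> real (nat \<lfloor>D / s\<rfloor>) + 1" by simp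
  also have "\<dots> \<le> D / s + 1" using D s by simp
  finally show ?thesis using fin by simp
qed (use D s in simp)


text \<open>
  The children \<open>[u + i \<rho>, u + (i + 1) \<rho>]\<close> are closed, so a set of diameter \<open>D \<le> \<rho>\<close> can meet up to
  three of them.
\<close>

lemma card_children_meeting:
  fixes V :: "real set"
  assumes rho: "0 < \<rho>" and D: "0 \<le> D" and bd: "\<And>x y. x \<in> V \<Longrightarrow> y \<in> V \<Longrightarrow> \<bar>x - y\<bar> \<le> D"
  shows "real (card {i\<in>{..<N}. V \<inter> {u + real i * \<rho>..u + real (Suc i) * \<rho>} \<noteq> {}}) \<le> D / \<rho> + 2"
proof -
  let ?S = "{i\<in>{..<N}. V \<inter> {u + real i * \<rho>..u + real (Suc i) * \<rho>} \<noteq> {}}"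
  have "finite (real ` ?S) \<and> real (card (real ` ?S)) \<le> (D / \<rho> + 1) / 1 + 1"
  proof (rule card_separated_le)
    fix a b assume ab: "a \<in> real ` ?S" "b \<in> real ` ?S"
    show "1 \<le> \<bar>a - b\<bar>" if "a \<noteq> b" using ab that by auto
    from ab(1) obtain i where "i \<in> ?S" and ia: "a = real i" by (rule imageE)
    then obtain x where i: "x \<in> V" "u + real i * \<rho> \<le> x" "x \<le> u + real (Suc i) * \<rho>"
      by auto
    from ab(2) obtain j where "j \<in> ?S" and jb: "b = real j" by (rule imageE)
    then obtain y where j: "y \<in> V" "u + real j * \<rho> \<le> y" "y \<le> u + real (Suc j) * \<rho>"
      by auto
    have "\<bar>real i - real j\<bar> * \<rho> \<le> D + \<rho>"
      using bd[OF i(1) j(1)] i(2,3) j(2,3)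
      by (cases "i \<le> j") (auto simp: abs_if algebra_simps split: if_splits)
    thus "\<bar>a - b\<bar> \<le> D / \<rho> + 1" using ia jb rho by (simp add: field_simps)
  qed (use D rho in auto)
  thus ?thesis by (simp add: card_image)
qed

section \<open>Bounding Hausdorff dimension\<close>

text \<open>
  One common diameter bound \<open>d\<close> for all pieces is enough for self-similar sets, and it replaces the
  infinite sum in the definition of the premeasure by \<open>card T \<cdot> d powr s\<close>.
\<close>

lemma hausdorff_dim_le:
  fixes A :: "'a::metric_space set"
  assumes s: "0 < s"
    and cover: "\<And>\<delta> \<eta>. 0 < \<delta> \<Longrightarrow> 0 < \<eta> \<Longrightarrow> \<exists>(T :: 'b set) W d. finite T \<and> A \<subseteq> \<Union> (W ` T) \<and> 0 \<le> d \<and> d \<le> \<delta> \<and>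
           (\<forall>t\<in>T. \<forall>x\<in>W t. \<forall>y\<in>W t. dist x y \<le> d) \<and> real (card T) * d powr s \<le> \<eta>"
  shows "hausdorff_dim A \<le> ereal s"
proof -
  have small: "hausdorff_premeasure s \<delta> A \<le> ennreal \<eta>" if \<delta>: "0 < \<delta>" and \<eta>: "0 < \<eta>" for \<delta> \<eta>
  proof -
    obtain T :: "'b set" and W d where T: "finite T" "A \<subseteq> \<Union> (W ` T)" and d: "0 \<le> d" "d \<le> \<delta>"
      and W: "\<And>t x y. t \<in> T \<Longrightarrow> x \<in> W t \<Longrightarrow> y \<in> W t \<Longrightarrow> dist x y \<le> d"
      and small: "real (card T) * d powr s \<le> \<eta>"
      using cover[OF \<delta> \<eta>] by blast
    obtain b where b: "bij_betw b {0..<card T} T" using ex_bij_betw_nat_finite[OF T(1)] by blast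
    define U where "U = (\<lambda>i. if i < card T then W (b i) else {})"
    have bT: "b i \<in> T" if "i < card T" for i using b that by (auto simp: bij_betw_def)
    have bddW: "bounded (W t)" if "t \<in> T" for t
      unfolding bounded_two_points by (intro exI[of _ d] ballI W[OF that])
    have diamW: "diameter (W t) \<le> d" if "t \<in> T" for t
    proof (cases "W t = {}")
      case False
      hence "(SUP (x, y)\<in>W t \<times> W t. dist x y) \<le> d"
        by (intro cSUP_least) (use W[OF that] in auto)
      thus ?thesis using False by (simp add: diameter_def)
    qed (use d in simp)
    have "A \<subseteq> (\<Union>i. U i)"
    proof
      fix x assume "x \<in> A"
      then obtain t where t: "t \<in> T" "x \<in> W t" using T(2) by blast
      hence "t \<in> b ` {0..<card T}" using bij_betw_imp_surj_on[OF b] by simp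
      then obtain i where "i < card T" "t = b i" by auto
      hence "x \<in> U i" using t by (simp add: U_def)
      thus "x \<in> (\<Union>i. U i)" by blast
    qed
    moreover have "bounded (U i) \<and> diameter (U i) \<le> \<delta>" for i
      using bddW[OF bT] diamW[OF bT] d \<delta> by (auto simp: U_def intro: order_trans)
    ultimately have "hausdorff_premeasure s \<delta> A \<le> (\<Sum>i. ennreal (diam_weight s (U i)))"
      unfolding hausdorff_premeasure_def by (intro INF_lower) auto
    also have "\<dots> = (\<Sum>i<card T. ennreal (diam_weight s (U i)))"
      by (rule suminf_finite) (auto simp: U_def diam_weight_def)
    also have "\<dots> \<le> (\<Sum>i<card T. ennreal (d powr s))"
    proof (rule sum_mono)
      fix i assume "i \<in> {..<card T}"
      hence "diameter (U i) \<le> d" "0 \<le> diameter (U i)"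
        using diamW[OF bT] diameter_ge_0[OF bddW[OF bT]] by (auto simp: U_def)
      thus "ennreal (diam_weight s (U i)) \<le> ennreal (d powr s)"
        using s d by (auto simp: diam_weight_def intro!: ennreal_leI powr_mono2)
    qed
    also have "\<dots> = ennreal (\<Sum>i<card T. d powr s)" by (rule sum_ennreal) simp
    also have "\<dots> = ennreal (real (card T) * d powr s)" by simp
    also have "\<dots> \<le> ennreal \<eta>" using small by (rule ennreal_leI)
    finally show ?thesis .
  qed
  have "hausdorff_premeasure s \<delta> A = 0" if "0 < \<delta>" for \<delta>
  proof -
    have "hausdorff_premeasure s \<delta> A \<le> 0 + ennreal \<eta>" if "0 < \<eta>" for \<eta>
      using small[OF \<open>0 < \<delta>\<close> that] by simp
    hence "hausdorff_premeasure s \<delta> A \<le> 0" by (rule ennreal_le_epsilon)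
    thus ?thesis by simp
  qed
  hence "hausdorff_measure s A = 0" unfolding hausdorff_measure_def by simp
  thus ?thesis unfolding hausdorff_dim_def using s by (intro INF_lower) auto
qed

text \<open>
  The sizes \<open>r i\<close> that are tested here are strictly positive, although members of a cover may have
  diameter \<open>0\<close>: the proof enlarges each \<open>(diam (U i)) powr s\<close> by a term of a small geometric series.
  A cover for an exponent \<open>t < s\<close> by sets of diameter at most \<open>1\<close> is also cheap for the exponent
  \<open>s\<close>, because powers of numbers in \<open>[0, 1]\<close> decrease in the exponent; this includes \<open>t = 0\<close>.
\<close>

lemma hausdorff_dim_ge:
  fixes A :: "'a::metric_space set"
  assumes s: "0 < s" and c: "0 < c"
    and escape: "\<And>(V :: nat \<Rightarrow> 'a set) r. (\<And>i. 0 < r i) \<Longrightarrow> (\<And>i x y. x \<in> V i \<Longrightarrow> y \<in> V i \<Longrightarrow> dist x y \<le> r i) \<Longrightarrow>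
          summable (\<lambda>i. r i powr s) \<Longrightarrow> (\<Sum>i. r i powr s) \<le> c \<Longrightarrow> \<exists>x\<in>A. \<forall>i. x \<notin> V i"
  shows "ereal s \<le> hausdorff_dim A"
  unfolding hausdorff_dim_def
proof (rule INF_greatest, rule ccontr)
  fix t assume "t \<in> {s. 0 \<le> s \<and> hausdorff_measure s A = 0}" and "\<not> ereal s \<le> ereal t"
  hence t: "0 \<le> t" "t < s" and meas: "hausdorff_measure t A = 0" by auto
  have "hausdorff_premeasure t 1 A \<le> hausdorff_measure t A"
    unfolding hausdorff_measure_def by (rule SUP_upper) auto
  hence "hausdorff_premeasure t 1 A < ennreal (c / 2)" using meas c by simp
  then obtain U :: "nat \<Rightarrow> 'a set" where U: "A \<subseteq> (\<Union>i. U i)" "\<And>i. bounded (U i)" "\<And>i. diameter (U i) \<le> 1"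
    and sum: "(\<Sum>i. ennreal (diam_weight t (U i))) < ennreal (c / 2)"
    unfolding hausdorff_premeasure_def INF_less_iff by auto
  define D where "D = (\<lambda>i. diameter (U i))"
  have D: "0 \<le> D i" "D i \<le> 1" for i using U diameter_ge_0 by (auto simp: D_def)
  have w0: "0 \<le> diam_weight t (U i)" for i by (auto simp: diam_weight_def)
  have wD: "D i powr s \<le> diam_weight t (U i)" for i
  proof -
    have "D i powr s \<le> D i powr t" if "0 < D i" using D[of i] t that by (intro powr_mono') auto
    moreover have "D i powr s \<le> 1" using D[of i] s by (intro powr_le1) auto
    ultimately show ?thesis
      using D[of i] by (cases "D i = 0") (auto simp: diam_weight_def D_def)
  qed
  have sw: "summable (\<lambda>i. diam_weight t (U i))"
    using sum w0 by (intro summable_suminf_not_top) auto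
  have "ennreal (\<Sum>i. diam_weight t (U i)) < ennreal (c / 2)"
    using sum suminf_ennreal2[OF w0 sw] by simp
  hence lw: "(\<Sum>i. diam_weight t (U i)) < c / 2" using c by (simp add: ennreal_less_iff suminf_nonneg sw w0)
  define q where "q = (\<lambda>i. D i powr s + c / 2 * (1/2) ^ Suc i)"
  define r where "r = (\<lambda>i. q i powr (1 / s))"
  have q: "0 < q i" for i using c by (auto simp: q_def intro!: add_nonneg_pos)
  have r: "r i powr s = q i" for i using q[of i] s by (simp add: r_def powr_powr)
  have sD: "summable (\<lambda>i. D i powr s)"
    by (rule summable_comparison_test[OF _ sw]) (use wD in auto)
  have geo: "(\<lambda>i. c / 2 * (1/2) ^ Suc i) sums (c / 2 * 1)"
    by (intro sums_mult power_half_series)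
  have "summable q" unfolding q_def by (intro summable_add sD sums_summable[OF geo])
  have "(\<Sum>i. q i) = (\<Sum>i. D i powr s) + c / 2"
    unfolding q_def using suminf_add[OF sD sums_summable[OF geo]] sums_unique[OF geo] by simp
  moreover have "(\<Sum>i. D i powr s) \<le> (\<Sum>i. diam_weight t (U i))"
    by (rule suminf_le[OF wD sD sw])
  ultimately have "(\<Sum>i. q i) \<le> c" using lw by simp
  have "\<exists>x\<in>A. \<forall>i. x \<notin> U i"
  proof (rule escape)
    show "0 < r i" for i using q[of i] by (simp add: r_def)
    show "dist x y \<le> r i" if "x \<in> U i" "y \<in> U i" for i x y
    proof -
      have "dist x y \<le> D i" unfolding D_def by (rule diameter_bounded_bound[OF U(2) that])
      also have "\<dots> = (D i powr s) powr (1 / s)" using D s by (simp add: powr_powr)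
      also have "\<dots> \<le> r i" unfolding r_def q_def using c s by (intro powr_mono2) auto
      finally show ?thesis .
    qed
    show "summable (\<lambda>i. r i powr s)" "(\<Sum>i. r i powr s) \<le> c"
      using \<open>summable q\<close> \<open>(\<Sum>i. q i) \<le> c\<close> by (simp_all add: r)
  qed
  thus False using U(1) by blast
qed

section \<open>Level intervals and gaps of the Cantor set\<close>

fun left_ends :: "real \<Rightarrow> nat \<Rightarrow> real set" where
  "left_ends l 0 = {0}"
| "left_ends l (Suc n) =
     (\<lambda>x. l * x) ` left_ends l n \<union> (\<lambda>x. l * x + 1 - l) ` left_ends l n"

lemma card_left_ends: "finite (left_ends l n) \<and> card (left_ends l n) \<le> 2 ^ n"
proof (induction n)
  case (Suc n)
  let ?A = "left_ends l n"
  have "card (left_ends l (Suc n)) \<le> card ((\<lambda>x. l * x) ` ?A) + card ((\<lambda>x. l * x + 1 - l) ` ?A)"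
    by (simp add: card_Un_le)
  also have "\<dots> \<le> card ?A + card ?A" using Suc by (intro add_mono card_image_le) auto
  finally show ?case using Suc by auto
qed simp

lemma cantor_set_subset_level_intervals:
  assumes l: "0 < l" "l < 1/2"
  shows "cantor_set l \<subseteq> (\<Union>a\<in>left_ends l n. {a..a + l ^ n})"
proof (induction n)
  case 0 thus ?case using cantor_set(2)[OF l] by simp
next
  case (Suc n)
  show ?case
  proof
    fix x assume "x \<in> cantor_set l"
    then obtain y c where y: "y \<in> cantor_set l" and c: "c = 0 \<or> c = 1 - l" and x: "x = l * y + c"
      using cantor_set(1)[OF l] unfolding cantor_equation_def
      by (smt (verit, best) UnE imageE)
    obtain a where a: "a \<in> left_ends l n" "a \<le> y" "y \<le> a + l ^ n" using Suc y by auto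
    have "l * a + c \<in> left_ends l (Suc n)" using a c by (auto simp: add_diff_eq)
    moreover have "l * a \<le> l * y" "l * y \<le> l * (a + l ^ n)" using a l by (auto intro!: mult_left_mono)
    hence "x \<in> {l * a + c..l * a + c + l ^ Suc n}" using x by (simp add: algebra_simps)
    ultimately show "x \<in> (\<Union>a\<in>left_ends l (Suc n). {a..a + l ^ Suc n})" by blast
  qed
qed

text \<open>
  The centres of the \<open>2 ^ n\<close> open intervals of length \<open>(1 - 2l) l ^ n\<close> that are removed from the
  unit interval in step \<open>n\<close>.
\<close>

fun gap_centres :: "real \<Rightarrow> nat \<Rightarrow> real set" where
  "gap_centres l 0 = {1/2}"
| "gap_centres l (Suc n) =
     (\<lambda>x. l * x) ` gap_centres l n \<union> (\<lambda>x. l * x + 1 - l) ` gap_centres l n"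

text \<open>
  A gap of level \<open>n\<close> is the middle part of an interval of length \<open>l ^ n\<close>, whose half-length
  separates its centre from \<open>0\<close> and \<open>1\<close>. This makes the induction for \<open>gap_centres_separated\<close>
  work for two centres in different copies.
\<close>

lemma gap_centres_bounds:
  assumes l: "0 < l" "l < 1/2" and "p \<in> gap_centres l n"
  shows "l ^ n / 2 \<le> p \<and> p \<le> 1 - l ^ n / 2"
  using assms(3)
proof (induction n arbitrary: p)
  case 0 thus ?case by simp
next
  case (Suc n)
  then obtain q where q: "q \<in> gap_centres l n" "p = l * q \<or> p = l * q + 1 - l" by auto
  have "l * (l ^ n / 2) \<le> l * q" "l * q \<le> l * (1 - l ^ n / 2)"
    using Suc.IH[OF q(1)] l by (auto intro!: mult_left_mono)
  hence a: "l ^ Suc n / 2 \<le> l * q" "l * q \<le> l - l ^ Suc n / 2" by (simp_all add: algebra_simps)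
  show ?case using q(2) by (rule disjE) (use a l in linarith)+
qed

lemma gap_centres_separated:
  assumes l: "0 < l" "l < 1/2" and "p \<in> gap_centres l n" "q \<in> gap_centres l n" "p \<noteq> q"
  shows "l ^ n \<le> \<bar>p - q\<bar>"
  using assms(3-5)
proof (induction n arbitrary: p q)
  case 0 thus ?case by simp
next
  case (Suc n)
  have cross: "l ^ Suc n \<le> (l * b + 1 - l) - l * a"
    if "a \<in> gap_centres l n" "b \<in> gap_centres l n" for a b
  proof -
    have "l * (l ^ n / 2) \<le> l * b" "l * a \<le> l * (1 - l ^ n / 2)"
      using gap_centres_bounds[OF l that(1)] gap_centres_bounds[OF l that(2)] l
      by (auto intro!: mult_left_mono)
    hence "l ^ Suc n / 2 \<le> l * b" "l * a \<le> l - l ^ Suc n / 2" by (simp_all add: algebra_simps)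
    thus ?thesis using l by linarith
  qed
  have same: "l ^ Suc n \<le> \<bar>l * a - l * b\<bar>"
    if "a \<in> gap_centres l n" "b \<in> gap_centres l n" "a \<noteq> b" for a b
    using Suc.IH[OF that] l by (simp add: abs_mult flip: right_diff_distrib)
  obtain a where a: "a \<in> gap_centres l n" "p = l * a \<or> p = l * a + 1 - l"
    using Suc.prems(1) by auto
  obtain b where b: "b \<in> gap_centres l n" "q = l * b \<or> q = l * b + 1 - l"
    using Suc.prems(2) by auto
  show ?case
    using a(2) b(2) cross[OF a(1) b(1)] cross[OF b(1) a(1)] same[OF a(1) b(1)] Suc.prems(3)
    by auto
qed

text \<open>
  A point \<open>x\<close> outside the middle gap is the image of some \<open>z\<close> in the unit interval under one of the
  two contractions, and \<open>z\<close> avoids all gaps because that contraction maps the gaps of level \<open>k\<close> to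
  gaps of level \<open>Suc k\<close>. Iterating \<open>n\<close> times shows that \<open>x\<close> has distance at most \<open>l ^ n\<close> from the
  Cantor set, which is closed.
\<close>

lemma mem_cantor_set_if_avoids_gaps:
  assumes l: "0 < l" "l < 1/2" and x: "0 \<le> x" "x \<le> 1"
    and av: "\<And>n p. p \<in> gap_centres l n \<Longrightarrow> (1 - 2 * l) * l ^ n / 2 \<le> \<bar>x - p\<bar>"
  shows "x \<in> cantor_set l"
proof -
  let ?K = "cantor_set l"
  note K = cantor_set(1)[OF l, unfolded cantor_equation_def]
  have inv: "l * y \<in> ?K" "l * y + 1 - l \<in> ?K" if "y \<in> ?K" for y
    using K that by blast+
  define avoids where "avoids = (\<lambda>x. 0 \<le> x \<and> x \<le> 1 \<and>
    (\<forall>n. \<forall>p\<in>gap_centres l n. (1 - 2 * l) * l ^ n / 2 \<le> \<bar>x - p\<bar>))"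
  have close: "\<exists>y\<in>?K. \<bar>x - y\<bar> \<le> l ^ n" if "avoids x" for n x
    using that
  proof (induction n arbitrary: x)
    case 0
    obtain y where "y \<in> ?K" using K by blast
    moreover from this have "y \<in> {0..1}" using cantor_set(2)[OF l] by blast
    hence "\<bar>x - y\<bar> \<le> 1" using 0 by (auto simp: avoids_def abs_if)
    ultimately show ?case by auto
  next
    case (Suc n)
    have "(1 - 2 * l) * l ^ 0 / 2 \<le> \<bar>x - 1/2\<bar>"
      using Suc.prems unfolding avoids_def by (metis gap_centres.simps(1) insertI1)
    hence sides: "x \<le> l \<or> 1 - l \<le> x" by (auto simp: abs_if split: if_splits)
    obtain c z where c: "c = 0 \<or> c = 1 - l" and z: "x = l * z + c" "0 \<le> z" "z \<le> 1"
    proof (cases "x \<le> l")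
      case True
      thus ?thesis using that[of 0 "x / l"] Suc.prems l by (simp add: avoids_def)
    next
      case False
      thus ?thesis using that[of "1 - l" "(x - (1 - l)) / l"] Suc.prems l sides
        by (simp add: avoids_def)
    qed
    have "avoids z"
      unfolding avoids_def
    proof (intro conjI allI ballI)
      fix k p assume p: "p \<in> gap_centres l k"
      hence "l * p + c \<in> gap_centres l (Suc k)" using c by (auto simp: add_diff_eq)
      hence "(1 - 2 * l) * l ^ Suc k / 2 \<le> \<bar>x - (l * p + c)\<bar>"
        using Suc.prems unfolding avoids_def by blast
      also have "x - (l * p + c) = l * (z - p)" using z by (simp add: algebra_simps)
      also have "\<bar>l * (z - p)\<bar> = l * \<bar>z - p\<bar>" using l by (simp add: abs_mult)
      finally have "l * ((1 - 2 * l) * l ^ k / 2) \<le> l * \<bar>z - p\<bar>" by (simp add: algebra_simps)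
      thus "(1 - 2 * l) * l ^ k / 2 \<le> \<bar>z - p\<bar>" using l by simp
    qed (use z in auto)
    then obtain y where y: "y \<in> ?K" "\<bar>z - y\<bar> \<le> l ^ n" using Suc.IH by blast
    have "l * y + c \<in> ?K" using inv[OF y(1)] c by (auto simp: add_diff_eq)
    moreover have "\<bar>x - (l * y + c)\<bar> \<le> l ^ Suc n"
    proof -
      have "x - (l * y + c) = l * (z - y)" using z by (simp add: algebra_simps)
      thus ?thesis using y(2) l by (simp add: abs_mult)
    qed
    ultimately show ?case by blast
  qed
  have "avoids x" using x av by (auto simp: avoids_def)
  have "infdist x ?K \<le> l ^ n" for n
  proof -
    obtain y where "y \<in> ?K" "\<bar>x - y\<bar> \<le> l ^ n" using close[OF \<open>avoids x\<close>] by blast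
    thus ?thesis using infdist_le[of y ?K x] by (simp add: dist_real_def)
  qed
  moreover have "(\<lambda>n. l ^ n) \<longlonglongrightarrow> 0" using l by (intro LIMSEQ_power_zero) auto
  ultimately have "infdist x ?K \<le> 0"
    by (intro LIMSEQ_le_const[of "\<lambda>n. l ^ n"]) auto
  hence "infdist x ?K = 0" using infdist_nonneg[of x ?K] by linarith
  thus ?thesis using K compact_imp_closed in_closed_iff_infdist_zero by blast
qed

section \<open>The dimension of the intersection is at most that of the Cantor set\<close>

text \<open>
  For \<open>0 \<le> x \<le> y\<close> on the circle, \<open>(y - y') (y + y') = (x' - x) (x + x')\<close> shows that \<open>y\<close> is a
  \<open>1\<close>-Lipschitz function of \<open>x\<close>; below the diagonal the coordinates exchange roles. For
  \<open>s > ln 2 / ln (1/l)\<close>, that is \<open>2 l powr s < 1\<close>, the sums of the resulting covers tend to \<open>0\<close>.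
\<close>

lemma hausdorff_dim_cantor_circle_le:
  assumes l: "0 < l" "l < 1/2"
  shows "hausdorff_dim (cantor_circle l) \<le> ereal (ln 2 / ln (1 / l))"
proof -
  have lnl: "0 < ln (1 / l)" "ln 2 < ln (1 / l)" using l by (auto simp: field_simps)
  have "hausdorff_dim (cantor_circle l) \<le> ereal s" if s: "ln 2 / ln (1 / l) < s" for s
  proof (rule hausdorff_dim_le)
    show s0: "0 < s" using s lnl by (meson divide_pos_pos ln_gt_zero order.strict_trans one_less_numeral_iff semiring_norm(76))
    \<comment> \<open>the ratio of the sums for consecutive levels\<close>
    define z where "z = 2 * l powr s"
    have z: "0 < z" "z < 1"
    proof -
      have "ln z = ln 2 + s * ln l" using l by (simp add: z_def ln_mult ln_powr)
      moreover have "ln 2 < s * ln (1 / l)" using s lnl by (simp add: pos_divide_less_eq)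
      ultimately have "ln z < 0" using l by (simp add: ln_div)
      moreover show "0 < z" using l by (simp add: z_def)
      ultimately show "z < 1" by simp
    qed
    fix \<delta> \<eta> :: real assume \<delta>: "0 < \<delta>" and \<eta>: "0 < \<eta>"
    have "(\<lambda>n. 2 * l ^ n) \<longlonglongrightarrow> 2 * 0" using l by (intro tendsto_intros LIMSEQ_power_zero) auto
    hence ev1: "\<forall>\<^sub>F n in sequentially. 2 * l ^ n < \<delta>" by (rule order_tendstoD) (use \<delta> in simp)
    have "(\<lambda>n. 2 * 2 powr s * z ^ n) \<longlonglongrightarrow> 2 * 2 powr s * 0" using z by (intro tendsto_intros LIMSEQ_power_zero) auto
    hence ev2: "\<forall>\<^sub>F n in sequentially. 2 * 2 powr s * z ^ n < \<eta>" by (rule order_tendstoD) (use \<eta> in simp)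
    obtain n where n: "2 * l ^ n < \<delta>" "2 * 2 powr s * z ^ n < \<eta>"
      using eventually_happens[OF eventually_conj[OF ev1 ev2]] by auto
    define T where "T = left_ends l n \<times> (UNIV :: bool set)"
    define arc where "arc = {p :: real \<times> real. 0 \<le> fst p \<and> fst p \<le> snd p \<and> (fst p)\<^sup>2 + (snd p)\<^sup>2 = 1}"
    define W where "W = (\<lambda>(a, b). if b then {p \<in> arc. fst p \<in> {a..a + l ^ n}}
                         else {p. (snd p, fst p) \<in> arc \<and> snd p \<in> {a..a + l ^ n}})"
    have arc: "dist p p' \<le> 2 * \<bar>fst p - fst p'\<bar>" if "p \<in> arc" "p' \<in> arc" for p p'
    proof -
      obtain x y x' y' where p: "p = (x, y)" "p' = (x', y')" by fastforce
      have h: "0 \<le> x" "x \<le> y" "x\<^sup>2 + y\<^sup>2 = 1" "0 \<le> x'" "x' \<le> y'" "x'\<^sup>2 + y'\<^sup>2 = 1"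
        using that by (auto simp: p arc_def)
      have "y \<noteq> 0" using h by (cases "y = 0") auto
      hence "0 < y + y'" using h by linarith
      have "(y - y') * (y + y') = (x' - x) * (x + x')" using h(3,6) by (simp add: algebra_simps power2_eq_square)
      hence "\<bar>y - y'\<bar> * \<bar>y + y'\<bar> = \<bar>x - x'\<bar> * \<bar>x + x'\<bar>"
        unfolding abs_minus_commute[of x] abs_mult[symmetric] by (rule arg_cong)
      hence "\<bar>y - y'\<bar> * (y + y') = \<bar>x - x'\<bar> * (x + x')" using h \<open>0 < y + y'\<close> by simp
      also have "\<dots> \<le> \<bar>x - x'\<bar> * (y + y')" using h by (intro mult_left_mono) auto
      finally have "\<bar>y - y'\<bar> \<le> \<bar>x - x'\<bar>" using \<open>0 < y + y'\<close> by simp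
      moreover have "dist p p' \<le> \<bar>x - x'\<bar> + \<bar>y - y'\<bar>"
        by (simp add: p dist_prod_def dist_real_def sqrt_sum_squares_le_sum_abs)
      ultimately show ?thesis by (simp add: p)
    qed
    have fin: "finite T" and cT: "card T \<le> 2 * 2 ^ n"
      using card_left_ends[of l n] by (auto simp: T_def card_cartesian_product)
    have cov: "cantor_circle l \<subseteq> \<Union> (W ` T)"
    proof
      fix p assume "p \<in> cantor_circle l"
      then obtain x y where p: "p = (x, y)" and xy: "x \<in> cantor_set l" "y \<in> cantor_set l" "x\<^sup>2 + y\<^sup>2 = 1"
        by (auto simp: cantor_circle_def)
      have nn: "0 \<le> x" "0 \<le> y" using xy cantor_set(2)[OF l] by auto
      obtain a where a: "a \<in> left_ends l n" "x \<in> {a..a + l ^ n}"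
        using cantor_set_subset_level_intervals[OF l] xy(1) by blast
      obtain b where b: "b \<in> left_ends l n" "y \<in> {b..b + l ^ n}"
        using cantor_set_subset_level_intervals[OF l] xy(2) by blast
      show "p \<in> \<Union> (W ` T)"
      proof (cases "x \<le> y")
        case True
        hence "p \<in> W (a, True)" using nn xy a by (simp add: W_def arc_def p)
        thus ?thesis using a by (auto simp: T_def)
      next
        case False
        hence "p \<in> W (b, False)" using nn xy b by (simp add: W_def arc_def p add.commute)
        thus ?thesis using b by (auto simp: T_def)
      qed
    qed
    have dW: "dist p p' \<le> 2 * l ^ n" if "t \<in> T" "p \<in> W t" "p' \<in> W t" for t p p'
    proof (cases "snd t")
      case True
      hence pp: "p \<in> arc" "p' \<in> arc" "\<bar>fst p - fst p'\<bar> \<le> l ^ n"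
        using that(2,3) by (auto simp: W_def case_prod_beta abs_le_iff)
      have "dist p p' \<le> 2 * \<bar>fst p - fst p'\<bar>" by (rule arc[OF pp(1,2)])
      also have "\<dots> \<le> 2 * l ^ n" using pp(3) by simp
      finally show ?thesis .
    next
      case False
      hence pp: "(snd p, fst p) \<in> arc" "(snd p', fst p') \<in> arc" "\<bar>snd p - snd p'\<bar> \<le> l ^ n"
        using that(2,3) by (auto simp: W_def case_prod_beta abs_le_iff)
      have "dist p p' = dist (snd p, fst p) (snd p', fst p')"
        by (simp add: dist_prod_def add.commute)
      also have "\<dots> \<le> 2 * \<bar>snd p - snd p'\<bar>" using arc[OF pp(1,2)] by simp
      also have "\<dots> \<le> 2 * l ^ n" using pp(3) by simp
      finally show ?thesis .
    qed
    have "real (card T) \<le> real (2 * 2 ^ n)" using cT by (rule of_nat_mono)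
    hence "real (card T) * (2 * l ^ n) powr s \<le> (2 * 2 ^ n) * (2 * l ^ n) powr s"
      by (intro mult_right_mono) auto
    also have "\<dots> = (2 * 2 ^ n) * (2 powr s * (l powr s) ^ n)"
    proof -
      have "(l ^ n) powr s = (l powr real n) powr s" using l by (simp only: powr_realpow)
      also have "\<dots> = (l powr s) powr real n" by (simp only: powr_powr mult.commute)
      also have "\<dots> = (l powr s) ^ n" using l by (intro powr_realpow) simp
      finally have "(2 * l ^ n) powr s = 2 powr s * (l powr s) ^ n" using l by (simp add: powr_mult)
      thus ?thesis by (rule arg_cong)
    qed
    also have "\<dots> = 2 * 2 powr s * z ^ n"
      by (simp add: z_def power_mult_distrib)
    also have "\<dots> \<le> \<eta>" using n by simp
    finally have small: "real (card T) * (2 * l ^ n) powr s \<le> \<eta>" .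
    show "\<exists>(T :: (real \<times> bool) set) W d. finite T \<and> cantor_circle l \<subseteq> \<Union> (W ` T) \<and> 0 \<le> d \<and> d \<le> \<delta> \<and>
           (\<forall>t\<in>T. \<forall>x\<in>W t. \<forall>y\<in>W t. dist x y \<le> d) \<and> real (card T) * d powr s \<le> \<eta>"
      using fin cov dW small n l
      by (intro exI[of _ T] exI[of _ W] exI[of _ "2 * l ^ n"]) auto
  qed
  hence "hausdorff_dim (cantor_circle l) \<le> ereal (ln 2 / ln (1 / l)) + ereal d" if "0 < d" for d
    using that by simp
  thus ?thesis by (rule ereal_le_epsilon2)
qed

section \<open>Subintervals spoilt by gaps\<close>

text \<open>
  Here \<open>Q\<close> are the gap centres and \<open>g\<close> the gap length. The first factor bounds the number of gaps
  that \<open>h\<close> pulls back into the parent, the second one the number of children that one such preimage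
  meets. Stating this for a map \<open>h\<close> treats the gaps in both coordinates at once.
\<close>

lemma card_children_meeting_gaps:
  fixes h :: "real \<Rightarrow> real" and Q :: "real set"
  assumes rho: "0 < \<rho>" and g: "0 < g" and \<sigma>: "0 < \<sigma>"
    and lip: "\<And>x y. x \<in> {u..u + real N * \<rho>} \<Longrightarrow> y \<in> {u..u + real N * \<rho>} \<Longrightarrow>
                \<bar>h x - h y\<bar> \<le> 3/2 * \<bar>x - y\<bar> \<and> \<bar>x - y\<bar> \<le> 3/2 * \<bar>h x - h y\<bar>"
    and sep: "\<And>p q. p \<in> Q \<Longrightarrow> q \<in> Q \<Longrightarrow> p \<noteq> q \<Longrightarrow> \<sigma> \<le> \<bar>p - q\<bar>"
  shows "real (card {i\<in>{..<N}. \<exists>x\<in>{u + real i * \<rho>..u + real (Suc i) * \<rho>}. \<exists>p\<in>Q. \<bar>h x - p\<bar> < g / 2})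
     \<le> ((3/2 * (real N * \<rho>) + g) / \<sigma> + 1) * (3/2 * g / \<rho> + 2)"
proof -
  let ?I = "{u..u + real N * \<rho>}"
  let ?J = "\<lambda>i. {u + real i * \<rho>..u + real (Suc i) * \<rho>}"
  define Q' where "Q' = {p \<in> Q. \<exists>x\<in>?I. \<bar>h x - p\<bar> < g / 2}"
  define V where "V = (\<lambda>p. {x\<in>?I. \<bar>h x - p\<bar> < g / 2})"
  have J: "?J i \<subseteq> ?I" if "i < N" for i
  proof -
    have "real (Suc i) * \<rho> \<le> real N * \<rho>" using that rho by (intro mult_right_mono) auto
    moreover have "0 \<le> real i * \<rho>" using rho by simp
    ultimately show ?thesis by auto
  qed
  have Q': "finite Q' \<and> real (card Q') \<le> (3/2 * (real N * \<rho>) + g) / \<sigma> + 1"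
  proof (rule card_separated_le[OF \<sigma>])
    fix p q assume p: "p \<in> Q'" and q: "q \<in> Q'"
    show "\<sigma> \<le> \<bar>p - q\<bar>" if "p \<noteq> q" using sep that p q by (auto simp: Q'_def)
    obtain x where x: "x \<in> ?I" "\<bar>h x - p\<bar> < g / 2" using p by (auto simp: Q'_def)
    obtain y where y: "y \<in> ?I" "\<bar>h y - q\<bar> < g / 2" using q by (auto simp: Q'_def)
    have "\<bar>x - y\<bar> \<le> real N * \<rho>" using x y by (simp add: abs_le_iff)
    hence "3/2 * \<bar>x - y\<bar> \<le> 3/2 * (real N * \<rho>)" by (rule mult_left_mono) simp
    moreover have "\<bar>h x - h y\<bar> \<le> 3/2 * \<bar>x - y\<bar>" using lip[OF x(1) y(1)] by simp
    ultimately have "\<bar>h x - h y\<bar> \<le> 3/2 * (real N * \<rho>)" by (rule order_trans[rotated])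
    moreover have "\<bar>p - q\<bar> \<le> \<bar>h x - p\<bar> + \<bar>h y - q\<bar> + \<bar>h x - h y\<bar>" by linarith
    ultimately show "\<bar>p - q\<bar> \<le> 3/2 * (real N * \<rho>) + g" using x(2) y(2) by linarith
  qed (use rho g in auto)
  have Vc: "real (card {i\<in>{..<N}. V p \<inter> ?J i \<noteq> {}}) \<le> 3/2 * g / \<rho> + 2" for p
  proof (rule card_children_meeting[OF rho])
    fix x y assume x: "x \<in> V p" and y: "y \<in> V p"
    have "\<bar>h x - p\<bar> < g / 2" "\<bar>h y - p\<bar> < g / 2" using x y by (auto simp: V_def)
    hence "\<bar>h x - h y\<bar> \<le> g" by linarith
    hence "3/2 * \<bar>h x - h y\<bar> \<le> 3/2 * g" by (rule mult_left_mono) simp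
    moreover have "\<bar>x - y\<bar> \<le> 3/2 * \<bar>h x - h y\<bar>" using lip[of x y] x y by (simp add: V_def)
    ultimately show "\<bar>x - y\<bar> \<le> 3/2 * g" by (rule order_trans[rotated])
  qed (use g in auto)
  have "{i\<in>{..<N}. \<exists>x\<in>?J i. \<exists>p\<in>Q. \<bar>h x - p\<bar> < g / 2} \<subseteq> (\<Union>p\<in>Q'. {i\<in>{..<N}. V p \<inter> ?J i \<noteq> {}})"
  proof
    fix i assume "i \<in> {i\<in>{..<N}. \<exists>x\<in>?J i. \<exists>p\<in>Q. \<bar>h x - p\<bar> < g / 2}"
    then obtain x p where i: "i < N" and x: "x \<in> ?J i" and p: "p \<in> Q" "\<bar>h x - p\<bar> < g / 2" by blast
    have "x \<in> ?I" using J[OF i] x by blast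
    hence "p \<in> Q'" "x \<in> V p" using p unfolding Q'_def V_def by blast+
    thus "i \<in> (\<Union>p\<in>Q'. {i\<in>{..<N}. V p \<inter> ?J i \<noteq> {}})" using i x by blast
  qed
  hence "card {i\<in>{..<N}. \<exists>x\<in>?J i. \<exists>p\<in>Q. \<bar>h x - p\<bar> < g / 2}
      \<le> card (\<Union>p\<in>Q'. {i\<in>{..<N}. V p \<inter> ?J i \<noteq> {}})"
    using Q' by (intro card_mono) auto
  also have "\<dots> \<le> (\<Sum>p\<in>Q'. card {i\<in>{..<N}. V p \<inter> ?J i \<noteq> {}})"
    using Q' by (intro card_UN_le) auto
  finally have "real (card {i\<in>{..<N}. \<exists>x\<in>?J i. \<exists>p\<in>Q. \<bar>h x - p\<bar> < g / 2})
      \<le> (\<Sum>p\<in>Q'. real (card {i\<in>{..<N}. V p \<inter> ?J i \<noteq> {}}))"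
    unfolding of_nat_sum[symmetric] by (rule of_nat_mono)
  also have "\<dots> \<le> real (card Q') * (3/2 * g / \<rho> + 2)"
    by (rule sum_bounded_above) (use Vc in blast)
  also have "\<dots> \<le> ((3/2 * (real N * \<rho>) + g) / \<sigma> + 1) * (3/2 * g / \<rho> + 2)"
    using Q' g rho by (intro mult_right_mono) auto
  finally show ?thesis .
qed

definition meets_gap :: "real \<Rightarrow> (real \<Rightarrow> real) \<Rightarrow> nat \<Rightarrow> real set \<Rightarrow> bool" where
  "meets_gap l h k J \<longleftrightarrow> (\<exists>x\<in>J. \<exists>p\<in>gap_centres l k. \<bar>h x - p\<bar> < (1 - 2 * l) * l ^ k / 2)"

text \<open>
  A gap is large for an interval if it has at least \<open>1/32\<close> of its length. If no gap is large for
  the parent, those that are large for a child and meet it come from at most \<open>m\<close> consecutive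
  levels, since the gap lengths shrink by a factor below \<open>1/2\<close> and the interval by \<open>2 ^ m\<close>. In the bound
  of \<open>card_children_meeting_gaps\<close> the gap density contributes \<open>O(N e)\<close> for each of these levels,
  whereas the one or two gaps that each level may have regardless of density contribute four
  children per level and a geometric sum over the gap lengths. That sum is dominated by the longest
  gap, of at most \<open>1/32\<close> of the parent, hence the term \<open>3/16\<close>.
\<close>

lemma card_children_meeting_large_gaps:
  fixes h :: "real \<Rightarrow> real"
  assumes N_def: "N = 2 ^ m" and l: "0 < l" "l < 1/2" and rho: "0 < \<rho>"
    and lip: "\<And>x y. x \<in> {u..u + real N * \<rho>} \<Longrightarrow> y \<in> {u..u + real N * \<rho>} \<Longrightarrow>
                \<bar>h x - h y\<bar> \<le> 3/2 * \<bar>x - y\<bar> \<and> \<bar>x - y\<bar> \<le> 3/2 * \<bar>h x - h y\<bar>"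
    and parent: "\<And>k. real N * \<rho> / 32 \<le> (1 - 2 * l) * l ^ k \<Longrightarrow> \<not> meets_gap l h k {u..u + real N * \<rho>}"
  shows "real (card {i\<in>{..<N}. \<exists>k. \<rho> / 32 \<le> (1 - 2 * l) * l ^ k \<and>
            meets_gap l h k {u + real i * \<rho>..u + real (Suc i) * \<rho>}})
     \<le> real N * (100 * (real m * (1 - 2 * l)) + 3/16) + 4 * real m"
proof -
  let ?I = "{u..u + real N * \<rho>}"
  let ?J = "\<lambda>i. {u + real i * \<rho>..u + real (Suc i) * \<rho>}"
  define e where "e = 1 - 2 * l"
  have e: "0 < e" "e < 1" using l by (auto simp: e_def)
  define S where "S = {k. \<rho> / 32 \<le> e * l ^ k \<and> e * l ^ k < real N * \<rho> / 32}"
  have N: "real N = 2 ^ m" "0 < real N" by (simp_all add: N_def)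
  have "(\<lambda>k. e * l ^ k) \<longlonglongrightarrow> e * 0"
    using l by (intro tendsto_intros LIMSEQ_power_zero) auto
  hence "\<forall>\<^sub>F k in sequentially. e * l ^ k < real N * \<rho> / 32"
    by (rule order_tendstoD) (use N rho in simp)
  then obtain k1 where k1: "e * l ^ k1 < real N * \<rho> / 32" unfolding eventually_sequentially by blast
  \<comment> \<open>the first level whose gaps are not large for the parent\<close>
  define k0 where "k0 = (LEAST k. e * l ^ k < real N * \<rho> / 32)"
  have k0: "e * l ^ k0 < real N * \<rho> / 32" unfolding k0_def using k1 by (rule LeastI)
  have S: "S \<subseteq> {k0..<k0 + m}"
  proof
    fix k assume k: "k \<in> S"
    hence "k0 \<le> k" unfolding k0_def S_def by (intro Least_le) auto
    moreover have "k < k0 + m"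
    proof (rule ccontr)
      assume "\<not> k < k0 + m"
      hence "l ^ k \<le> l ^ (k0 + m)" using l by (intro power_decreasing) auto
      also have "\<dots> = l ^ k0 * l ^ m" by (rule power_add)
      also have "\<dots> \<le> l ^ k0 * (1/2) ^ m" using l by (intro mult_left_mono power_mono) auto
      finally have "e * l ^ k \<le> (e * l ^ k0) * (1/2) ^ m" using e by simp
      also have "\<dots> < (real N * \<rho> / 32) * (1/2) ^ m" using k0 by (intro mult_strict_right_mono) auto
      also have "\<dots> = \<rho> / 32" using N by (simp add: power_one_over)
      finally show False using k by (simp add: S_def)
    qed
    ultimately show "k \<in> {k0..<k0 + m}" by simp
  qed
  have finS: "finite S" using S finite_subset by blast
  have cS: "card S \<le> m" using card_mono[OF _ S] by simp
  have level: "real (card {i\<in>{..<N}. meets_gap l h k (?J i)}) \<le> 100 * real N * e + 4 + 3 / \<rho> * (e * l ^ k)"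
    if k: "k \<in> S" for k
  proof -
    have lk: "0 < l ^ k" using l by simp
    \<comment> \<open>the length of the parent in units of the gap distance, and of the gap in units of a child\<close>
    define a where "a = real N * \<rho> / l ^ k"
    define b where "b = e * l ^ k / \<rho>"
    have "real (card {i\<in>{..<N}. meets_gap l h k (?J i)})
       \<le> ((3/2 * (real N * \<rho>) + e * l ^ k) / l ^ k + 1) * (3/2 * (e * l ^ k) / \<rho> + 2)"
      unfolding meets_gap_def e_def[symmetric]
      by (rule card_children_meeting_gaps[OF rho _ lk lip gap_centres_separated[OF l]])
         (use lk e in auto)
    also have "\<dots> \<le> (3/2 * a + 2) * (3/2 * b + 2)"
      using lk e rho by (intro mult_mono) (auto simp: a_def b_def add_divide_distrib)
    also have "\<dots> = 9/4 * (a * b) + 3 * a + 3 * b + 4" by (simp add: algebra_simps)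
    also have "\<dots> \<le> 9/4 * (real N * e) + 3 * (32 * (real N * e)) + 3 * b + 4"
    proof (intro add_mono mult_left_mono order_refl)
      show "a * b \<le> real N * e" using l rho by (simp add: a_def b_def)
      have "\<rho> \<le> 32 * (e * l ^ k)" using k by (simp add: S_def)
      hence "real N * \<rho> \<le> real N * (32 * (e * l ^ k))" using N by (intro mult_left_mono) auto
      thus "a \<le> 32 * (real N * e)" using lk by (simp add: a_def pos_divide_le_eq mult.assoc mult.left_commute)
    qed auto
    also have "\<dots> \<le> 100 * real N * e + 4 + 3 / \<rho> * (e * l ^ k)"
      using N e by (simp add: b_def)
    finally show ?thesis .
  qed
  have "{i\<in>{..<N}. \<exists>k. \<rho> / 32 \<le> (1 - 2 * l) * l ^ k \<and> meets_gap l h k (?J i)}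
      \<subseteq> (\<Union>k\<in>S. {i\<in>{..<N}. meets_gap l h k (?J i)})"
  proof
    fix i assume "i \<in> {i\<in>{..<N}. \<exists>k. \<rho> / 32 \<le> (1 - 2 * l) * l ^ k \<and> meets_gap l h k (?J i)}"
    then obtain k where i: "i < N" and k: "\<rho> / 32 \<le> e * l ^ k" "meets_gap l h k (?J i)"
      by (auto simp: e_def)
    have "real (Suc i) * \<rho> \<le> real N * \<rho>" using i rho by (intro mult_right_mono) auto
    moreover have "0 \<le> real i * \<rho>" using rho by simp
    ultimately have "?J i \<subseteq> ?I" by auto
    hence "meets_gap l h k ?I" using k(2) unfolding meets_gap_def by blast
    hence "e * l ^ k < real N * \<rho> / 32" using parent[of k] unfolding e_def by (meson not_le)
    thus "i \<in> (\<Union>k\<in>S. {i\<in>{..<N}. meets_gap l h k (?J i)})" using i k by (auto simp: S_def)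
  qed
  hence "card {i\<in>{..<N}. \<exists>k. \<rho> / 32 \<le> (1 - 2 * l) * l ^ k \<and> meets_gap l h k (?J i)}
      \<le> card (\<Union>k\<in>S. {i\<in>{..<N}. meets_gap l h k (?J i)})"
    using finS by (intro card_mono) auto
  also have "\<dots> \<le> (\<Sum>k\<in>S. card {i\<in>{..<N}. meets_gap l h k (?J i)})"
    using finS by (intro card_UN_le) auto
  finally have "real (card {i\<in>{..<N}. \<exists>k. \<rho> / 32 \<le> (1 - 2 * l) * l ^ k \<and> meets_gap l h k (?J i)})
      \<le> (\<Sum>k\<in>S. real (card {i\<in>{..<N}. meets_gap l h k (?J i)}))"
    unfolding of_nat_sum[symmetric] by (rule of_nat_mono)
  also have "\<dots> \<le> (\<Sum>k\<in>S. 100 * real N * e + 4 + 3 / \<rho> * (e * l ^ k))"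
    by (rule sum_mono) (rule level)
  also have "\<dots> = real (card S) * (100 * real N * e + 4) + 3 / \<rho> * (\<Sum>k\<in>S. e * l ^ k)"
    by (simp add: sum.distrib sum_distrib_left)
  also have "\<dots> \<le> real m * (100 * real N * e + 4) + 3 / \<rho> * (2 * (real N * \<rho> / 32))"
  proof (intro add_mono mult_mono)
    have "(\<Sum>k\<in>S. e * l ^ k) \<le> (\<Sum>k\<in>{k0..<k0 + m}. e * l ^ k)"
      using e l by (intro sum_mono2 S) auto
    also have "\<dots> = (\<Sum>j<m. e * l ^ (k0 + j))"
      by (rule sum.reindex_bij_witness[of _ "\<lambda>j. k0 + j" "\<lambda>k. k - k0"]) auto
    also have "\<dots> = e * l ^ k0 * (\<Sum>j<m. l ^ j)" by (simp add: power_add sum_distrib_left mult.assoc)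
    also have "\<dots> \<le> e * l ^ k0 * 2"
    proof -
      have "(\<Sum>j<m. l ^ j) = (1 - l ^ m) / (1 - l)" using l by (simp add: sum_gp_strict)
      also have "\<dots> \<le> 1 / (1 - l)" using l by (intro divide_right_mono) auto
      also have "\<dots> \<le> 2" using l by (simp add: field_simps)
      finally show ?thesis using e l by (intro mult_left_mono) auto
    qed
    also have "\<dots> \<le> 2 * (real N * \<rho> / 32)" using k0 by (simp add: mult_ac)
    finally show "(\<Sum>k\<in>S. e * l ^ k) \<le> 2 * (real N * \<rho> / 32)" .
  qed (use cS e l rho in \<open>auto intro!: sum_nonneg\<close>)
  also have "\<dots> = real N * (100 * (real m * e) + 3/16) + 4 * real m"
    using rho by (simp add: field_simps)
  finally show ?thesis by (simp add: e_def)
qed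

section \<open>Limit points that escape a family of small sets\<close>

text \<open>
  A tree of intervals \<open>[u, u + L / N ^ n]\<close>, selected by \<open>good\<close>, with at least \<open>N / 10\<close> children
  per node. The weight \<open>w n u\<close> of a node is the sum of \<open>r i powr s\<close> over the \<open>V i\<close> that meet it, and
  the descent keeps \<open>w n u\<close> at most the \<open>s\<close>-th power of the length of a child. Then any \<open>V i\<close>
  that meets the node is no longer than a child and meets at most three children, so the weights of
  the children add up to at most \<open>3 w\<close>. Some good child therefore has weight at most
  \<open>30 w / N \<le> 32 w / N = w / N powr s\<close>, as required in the next generation. A limit
  point in \<open>V i\<close> would force \<open>r i\<close> below the length of every node.
\<close>

lemma nested_intervals_escape:
  fixes V :: "nat \<Rightarrow> real set" and good :: "nat \<Rightarrow> real \<Rightarrow> bool"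
  assumes L: "0 < L" and N: "0 < N" and s: "0 < s" and Ns: "real N powr s = real N / 32"
    and root: "good 0 u0"
    and children: "\<And>n u. good n u \<Longrightarrow>
       real N / 10 \<le> real (card {i\<in>{..<N}. good (Suc n) (u + real i * (L / real N ^ Suc n))})"
    and r: "\<And>i. 0 < r i" and V: "\<And>i x y. x \<in> V i \<Longrightarrow> y \<in> V i \<Longrightarrow> \<bar>x - y\<bar> \<le> r i"
    and q: "summable (\<lambda>i. r i powr s)" "(\<Sum>i. r i powr s) \<le> (L / real N) powr s"
  shows "\<exists>x. (\<forall>n. \<exists>u. good n u \<and> u \<le> x \<and> x \<le> u + L / real N ^ n) \<and> (\<forall>i. x \<notin> V i)"
proof -
  define \<rho> where "\<rho> = (\<lambda>n. L / real N ^ n)"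
  have \<rho>: "0 < \<rho> n" "\<rho> n = real N * \<rho> (Suc n)" for n using L N by (auto simp: \<rho>_def)
  define q where "q = (\<lambda>i. r i powr s)"
  define t where "t = (\<lambda>n u i. if V i \<inter> {u..u + \<rho> n} = {} then 0 else q i)"
  define w where "w = (\<lambda>n u. \<Sum>i. t n u i)"
  have q0: "0 < q i" for i using r[of i] by (simp add: q_def)
  have sq: "summable q" using q by (simp add: q_def)
  have t0: "0 \<le> t n u i" "t n u i \<le> q i" for n u i using q0[of i] by (auto simp: t_def)
  have st: "summable (t n u)" for n u
    by (rule summable_comparison_test[OF _ sq]) (use t0 in auto)
  have tw: "t n u i \<le> w n u" for n u i
    using sum_le_suminf[OF st, of "{i}" n u] t0 by (simp add: w_def)
  have size: "r i \<le> \<rho> n" if "q i \<le> \<rho> n powr s" for i n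
  proof (rule ccontr)
    assume "\<not> r i \<le> \<rho> n"
    hence "\<rho> n powr s < r i powr s" using \<rho>(1)[of n] s by (intro powr_less_mono2) auto
    thus False using that by (simp add: q_def)
  qed
  define P where "P = (\<lambda>n u. good n u \<and> w n u \<le> \<rho> (Suc n) powr s)"
  define R where "R = (\<lambda>n u u'. u \<le> u' \<and> u' + \<rho> (Suc n) \<le> u + \<rho> n)"
  have P0: "P 0 u0"
  proof -
    have "w 0 u0 \<le> (\<Sum>i. q i)" unfolding w_def using t0 by (intro suminf_le st sq) auto
    also have "\<dots> \<le> \<rho> (Suc 0) powr s" using q(2) by (simp add: q_def \<rho>_def)
    finally show ?thesis using root by (simp add: P_def)
  qed
  have step: "\<exists>u'. P (Suc n) u' \<and> R n u u'" if u: "P n u" for n u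
  proof -
    have g: "good n u" and wu: "w n u \<le> \<rho> (Suc n) powr s" using u by (auto simp: P_def)
    define c where "c = (\<lambda>i. u + real i * \<rho> (Suc n))"
    define G where "G = {i\<in>{..<N}. good (Suc n) (c i)}"
    have G: "finite G" "real N / 10 \<le> real (card G)"
      using children[OF g] by (auto simp: G_def c_def \<rho>_def)
    have cend: "c j + \<rho> (Suc n) = u + real (Suc j) * \<rho> (Suc n)" for j
      by (simp add: c_def algebra_simps)
    have inside: "u \<le> c j" "c j + \<rho> (Suc n) \<le> u + \<rho> n" if "j < N" for j
    proof -
      have "real (Suc j) * \<rho> (Suc n) \<le> real N * \<rho> (Suc n)"
        using that \<rho>(1)[of "Suc n"] by (intro mult_right_mono) auto
      thus "c j + \<rho> (Suc n) \<le> u + \<rho> n" unfolding cend using \<rho>(2)[of n] by simp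
      show "u \<le> c j" using \<rho>(1)[of "Suc n"] by (simp add: c_def)
    qed
    have three: "(\<Sum>j\<in>G. t (Suc n) (c j) i) \<le> 3 * t n u i" for i
    proof (cases "V i \<inter> {u..u + \<rho> n} = {}")
      case True
      have "t (Suc n) (c j) i = 0" if "j \<in> G" for j
      proof -
        have "{c j..c j + \<rho> (Suc n)} \<subseteq> {u..u + \<rho> n}" using inside[of j] that by (auto simp: G_def)
        thus ?thesis using True by (auto simp: t_def)
      qed
      thus ?thesis using t0(1)[of n u i] by simp
    next
      case False
      hence "r i powr s \<le> \<rho> (Suc n) powr s" using tw[of n u i] wu by (simp add: t_def q_def)
      hence ri: "r i \<le> \<rho> (Suc n)" by (intro size) (simp add: q_def)
      let ?H = "{j\<in>{..<N}. V i \<inter> {u + real j * \<rho> (Suc n)..u + real (Suc j) * \<rho> (Suc n)} \<noteq> {}}"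
      have "real (card ?H) \<le> r i / \<rho> (Suc n) + 2"
        by (rule card_children_meeting[OF \<rho>(1) less_imp_le[OF r] V])
      also have "\<dots> \<le> 3" using ri \<rho>(1)[of "Suc n"] by simp
      finally have H: "real (card ?H) \<le> 3" .
      have "(\<Sum>j\<in>G. t (Suc n) (c j) i) = (\<Sum>j\<in>G \<inter> ?H. q i)"
        by (rule sum.mono_neutral_cong_right)
           (use G in \<open>auto simp: t_def cend G_def c_def algebra_simps split: if_splits\<close>)
      also have "\<dots> \<le> real (card ?H) * q i"
        using q0[of i] by (auto intro!: mult_right_mono card_mono)
      also have "\<dots> \<le> 3 * q i" using H q0[of i] by (intro mult_right_mono) auto
      finally show ?thesis using False by (simp add: t_def)
    qed
    have "(\<Sum>j\<in>G. w (Suc n) (c j)) = (\<Sum>i. \<Sum>j\<in>G. t (Suc n) (c j) i)"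
      unfolding w_def by (rule suminf_sum[symmetric]) (rule st)
    also have "\<dots> \<le> (\<Sum>i. 3 * t n u i)"
      by (intro suminf_le three summable_sum st summable_mult)
    also have "\<dots> = 3 * w n u" unfolding w_def by (rule suminf_mult[OF st])
    finally have total: "(\<Sum>j\<in>G. w (Suc n) (c j)) \<le> 3 * w n u" .
    have "\<exists>j\<in>G. w (Suc n) (c j) \<le> \<rho> (Suc (Suc n)) powr s"
    proof (rule ccontr)
      assume "\<not> ?thesis"
      hence "real (card G) * \<rho> (Suc (Suc n)) powr s \<le> (\<Sum>j\<in>G. w (Suc n) (c j))"
        by (intro sum_bounded_below) auto
      also have "\<dots> \<le> 3 * w n u" by (rule total)
      also have "\<dots> \<le> 3 * (real N * \<rho> (Suc (Suc n))) powr s" using wu \<rho>(2)[of "Suc n"] by simp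
      also have "\<dots> = 3 * (real N / 32 * \<rho> (Suc (Suc n)) powr s)"
        using \<rho>(1)[of "Suc (Suc n)"] by (simp add: powr_mult Ns)
      also have "\<dots> < real N / 10 * \<rho> (Suc (Suc n)) powr s"
        using N \<rho>(1)[of "Suc (Suc n)"] by simp
      also have "\<dots> \<le> real (card G) * \<rho> (Suc (Suc n)) powr s" using G by (intro mult_right_mono) auto
      finally show False by simp
    qed
    then obtain j where "j \<in> G" "w (Suc n) (c j) \<le> \<rho> (Suc (Suc n)) powr s" by blast
    thus ?thesis using inside[of j] by (intro exI[of _ "c j"]) (auto simp: P_def R_def G_def)
  qed
  obtain u where u: "\<And>n. P n (u n)" "\<And>n. R n (u n) (u (Suc n))"
    using dependent_nat_choice[of P R, OF exI[of "P 0", OF P0] step] by blast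
  have incr: "u m \<le> u n \<and> u n + \<rho> n \<le> u m + \<rho> m" if "m \<le> n" for m n
    using that
  proof (induction rule: dec_induct)
    case (step k)
    thus ?case using u(2)[of k] unfolding R_def by linarith
  qed simp
  have bound: "u n \<le> u m + \<rho> m" for m n
    using incr[of m n] incr[of n m] \<rho>(1)[of n] \<rho>(1)[of m] by linarith
  define x where "x = (SUP n. u n)"
  have bdd: "bdd_above (range u)" by (rule bdd_aboveI[of _ "u 0 + \<rho> 0"]) (use bound in auto)
  have x: "u n \<le> x" "x \<le> u n + \<rho> n" for n
    unfolding x_def by (rule cSUP_upper[OF UNIV_I bdd], rule cSUP_least) (use bound in auto)
  have "x \<notin> V i" for i
  proof
    assume "x \<in> V i"
    moreover have "x \<in> {u n..u n + \<rho> n}" for n using x by simp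
    ultimately have "V i \<inter> {u n..u n + \<rho> n} \<noteq> {}" for n by blast
    hence rho_ge: "r i \<le> \<rho> (Suc n)" for n
      using tw[of n "u n" i] u(1)[of n] by (intro size) (simp add: t_def P_def)
    have "\<rho> \<longlonglongrightarrow> 0"
    proof -
      have "N \<noteq> 1" using Ns by auto
      hence "1 < real N" using N by simp
      hence "(\<lambda>n. L * inverse (real N) ^ n) \<longlonglongrightarrow> L * 0"
        by (intro tendsto_intros LIMSEQ_power_zero) (auto simp: inverse_less_1_iff)
      thus ?thesis by (simp add: \<rho>_def field_simps)
    qed
    hence "r i \<le> 0"
      by (rule LIMSEQ_le_const[OF LIMSEQ_Suc]) (use rho_ge in auto)
    thus False using r[of i] by simp
  qed
  moreover have "good n (u n) \<and> u n \<le> x \<and> x \<le> u n + L / real N ^ n" for n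
    using u(1)[of n] x[of n] by (simp add: P_def \<rho>_def)
  ultimately show ?thesis by blast
qed

section \<open>Dimension of the intersection from below\<close>

text \<open>
  The map preserves the interval \<open>[3/5, 4/5]\<close>, because \<open>(3/5, 4/5)\<close> lies on the circle; hence
  in \<open>(h x - h y) (h x + h y) = (y - x) (x + y)\<close> both sums lie in \<open>[6/5, 8/5]\<close>.
\<close>

lemma sqrt_circle_bilipschitz:
  fixes x y :: real
  assumes "x \<in> {3/5..4/5}" "y \<in> {3/5..4/5}"
  defines "h \<equiv> (\<lambda>x. sqrt (1 - x\<^sup>2))"
  shows "\<bar>h x - h y\<bar> \<le> 3/2 * \<bar>x - y\<bar> \<and> \<bar>x - y\<bar> \<le> 3/2 * \<bar>h x - h y\<bar>"
proof -
  have h: "3/5 \<le> h z" "h z \<le> 4/5" "(h z)\<^sup>2 = 1 - z\<^sup>2" if "z \<in> {3/5..4/5}" for z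
  proof -
    have "(3/5)\<^sup>2 \<le> z\<^sup>2" "z\<^sup>2 \<le> (4/5)\<^sup>2" using that by (auto intro!: power_mono)
    hence z: "9/25 \<le> z\<^sup>2" "z\<^sup>2 \<le> 16/25" by (simp_all add: power2_eq_square)
    show "3/5 \<le> h z" unfolding h_def by (rule real_le_rsqrt) (use z in \<open>simp add: power2_eq_square\<close>)
    show "h z \<le> 4/5" unfolding h_def by (rule real_le_lsqrt) (use z in \<open>simp_all add: power2_eq_square\<close>)
    show "(h z)\<^sup>2 = 1 - z\<^sup>2" unfolding h_def using z by simp
  qed
  define S where "S = h x + h y"
  define T where "T = x + y"
  have ST: "6/5 \<le> S" "S \<le> 8/5" "6/5 \<le> T" "T \<le> 8/5"
    using h(1,2)[OF assms(1)] h(1,2)[OF assms(2)] assms(1,2) by (auto simp: S_def T_def)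
  have "(h x - h y) * S = (y - x) * T"
    using h(3)[OF assms(1)] h(3)[OF assms(2)] by (simp add: S_def T_def power2_eq_square algebra_simps)
  hence "\<bar>h x - h y\<bar> * \<bar>S\<bar> = \<bar>x - y\<bar> * \<bar>T\<bar>"
    unfolding abs_minus_commute[of x] abs_mult[symmetric] by (rule arg_cong)
  hence eq: "\<bar>h x - h y\<bar> * S = \<bar>x - y\<bar> * T" using ST by simp
  have "\<bar>h x - h y\<bar> * (6/5) \<le> \<bar>h x - h y\<bar> * S" using ST by (intro mult_left_mono) auto
  also have "\<dots> \<le> \<bar>x - y\<bar> * (8/5)" unfolding eq using ST by (intro mult_left_mono) auto
  finally have 1: "\<bar>h x - h y\<bar> \<le> 4/3 * \<bar>x - y\<bar>" by simp
  have "\<bar>x - y\<bar> * (6/5) \<le> \<bar>x - y\<bar> * T" using ST by (intro mult_left_mono) auto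
  also have "\<dots> \<le> \<bar>h x - h y\<bar> * (8/5)" unfolding eq[symmetric] using ST by (intro mult_left_mono) auto
  finally have 2: "\<bar>x - y\<bar> \<le> 4/3 * \<bar>h x - h y\<bar>" by simp
  have weaken: "4/3 * c \<le> 3/2 * c" if "0 \<le> c" for c :: real using that by simp
  show ?thesis using order_trans[OF 1 weaken] order_trans[OF 2 weaken] by simp
qed

text \<open>
  The good nodes are the intervals without large gaps in either coordinate. Each coordinate spoils at
  most the proportion \<open>100/400 + 3/16 + 4 m / N \<le> 9/20\<close> of the children. Projecting a cover to the
  first axis does not increase diameters, so it is enough to escape from sets of real numbers.
\<close>

lemma hausdorff_dim_cantor_circle_ge:
  assumes l: "0 < l" "l < 1/2" and m: "12 \<le> m" "real m * (1 - 2 * l) \<le> 1/400" 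
  shows "ereal (1 - 5 / real m) \<le> hausdorff_dim (cantor_circle l)"
proof (rule hausdorff_dim_ge)
  define N :: nat where "N = 2 ^ m"
  define s where "s = 1 - 5 / real m"
  define e where "e = 1 - 2 * l"
  have e: "0 < e" "12 * e \<le> 1/400"
  proof -
    show "0 < e" using l by (simp add: e_def)
    hence "12 * e \<le> real m * e" using m by (intro mult_right_mono) auto
    thus "12 * e \<le> 1/400" using m by (simp add: e_def)
  qed
  have s: "0 < s" using m by (simp add: s_def field_simps)
  show "0 < 1 - 5 / real m" using s by (simp add: s_def)
  have N: "0 < N" "real N = 2 powr real m" by (simp_all add: N_def powr_realpow)
  \<comment> \<open>the exponent is chosen for this identity, with \<open>32 = 2 ^ 5 \<ge> 3 \<cdot> 10\<close>\<close>
  have Ns: "real N powr s = real N / 32"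
  proof -
    have "real m * s = real m - 5" using m by (simp add: s_def algebra_simps)
    hence "real N powr s = 2 powr (real m - 5)" by (simp add: N powr_powr)
    also have "\<dots> = real N / 2 powr 5" by (simp add: N powr_diff)
    finally show ?thesis by simp
  qed
  \<comment> \<open>this makes the term \<open>4 m\<close> of \<open>card_children_meeting_large_gaps\<close> at most \<open>N / 80\<close>\<close>
  have Nm: "320 * m \<le> N"
    unfolding N_def using m(1) by (induction rule: dec_induct) auto
  define L :: real where "L = 1/5"
  show "0 < (L / real N) powr s" using N by (simp add: L_def)
  define f where "f = (\<lambda>x::real. sqrt (1 - x\<^sup>2))"
  define \<rho> where "\<rho> = (\<lambda>n. L / real N ^ n)"
  have \<rho>: "0 < \<rho> n" "\<rho> n = real N * \<rho> (Suc n)" for n using N by (auto simp: \<rho>_def L_def)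
  define free where "free = (\<lambda>h J d. \<forall>k. d / 32 \<le> e * l ^ k \<longrightarrow> \<not> meets_gap l h k J)"
  define good where "good = (\<lambda>n u. 3/5 \<le> u \<and> u + \<rho> n \<le> 4/5 \<and>
    free id {u..u + \<rho> n} (\<rho> n) \<and> free f {u..u + \<rho> n} (\<rho> n))"
  have root: "good 0 (3/5)"
  proof -
    have "e * l ^ k < \<rho> 0 / 32" for k
    proof -
      have "e * l ^ k \<le> e * 1" using e l by (intro mult_left_mono power_le_one) auto
      also have "e * 1 < \<rho> 0 / 32" using e by (simp add: \<rho>_def L_def)
      finally show ?thesis .
    qed
    hence "free h J (\<rho> 0)" for h J unfolding free_def by (meson not_le)
    thus ?thesis by (simp add: good_def \<rho>_def L_def)
  qed
  have children: "real N / 10 \<le> real (card {i\<in>{..<N}. good (Suc n) (u + real i * \<rho> (Suc n))})"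
    if g: "good n u" for n u
  proof -
    let ?d = "\<rho> (Suc n)"
    let ?J = "\<lambda>i. {u + real i * ?d..u + real (Suc i) * ?d}"
    define bad where "bad = (\<lambda>h. {i\<in>{..<N}. \<exists>k. ?d / 32 \<le> (1 - 2 * l) * l ^ k \<and> meets_gap l h k (?J i)})"
    have I: "{u..u + real N * ?d} \<subseteq> {3/5..4/5}" using g \<rho>(2)[of n] by (auto simp: good_def)
    have cb: "real (card (bad h)) \<le> real N * (100 * (real m * (1 - 2 * l)) + 3/16) + 4 * real m"
      if h: "h = id \<or> h = f" for h
      unfolding bad_def
    proof (rule card_children_meeting_large_gaps[OF N_def l \<rho>(1)])
      fix x y assume "x \<in> {u..u + real N * ?d}" "y \<in> {u..u + real N * ?d}"
      hence "x \<in> {3/5..4/5}" "y \<in> {3/5..4/5}" using I by blast+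
      thus "\<bar>h x - h y\<bar> \<le> 3/2 * \<bar>x - y\<bar> \<and> \<bar>x - y\<bar> \<le> 3/2 * \<bar>h x - h y\<bar>"
        using h sqrt_circle_bilipschitz[of x y] by (auto simp: f_def)
    next
      fix k assume "real N * ?d / 32 \<le> (1 - 2 * l) * l ^ k"
      thus "\<not> meets_gap l h k {u..u + real N * ?d}"
        using g h \<rho>(2)[of n] by (auto simp: good_def free_def e_def)
    qed
    have "real (card (bad h)) \<le> 9/20 * real N" if h: "h = id \<or> h = f" for h
    proof -
      have "real N * (100 * (real m * (1 - 2 * l)) + 3/16) \<le> real N * (100 * (1/400) + 3/16)"
        using m by (intro mult_left_mono) auto
      moreover have "320 * real m \<le> real N" using Nm by linarith
      ultimately show ?thesis using cb[OF h] by simp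
    qed
    hence b: "real (card (bad id)) \<le> 9/20 * real N" "real (card (bad f)) \<le> 9/20 * real N" by auto
    have fin: "finite (bad h)" for h by (simp add: bad_def)
    let ?G = "{i\<in>{..<N}. good (Suc n) (u + real i * ?d)}"
    have "{..<N} \<subseteq> ?G \<union> (bad id \<union> bad f)"
    proof
      fix i assume i: "i \<in> {..<N}"
      have "real (Suc i) * ?d \<le> real N * ?d" using i \<rho>(1)[of "Suc n"] by (intro mult_right_mono) auto
      moreover have "0 \<le> real i * ?d" using \<rho>(1)[of "Suc n"] by simp
      moreover have "3/5 \<le> u" "u + real N * ?d \<le> 4/5" using g \<rho>(2)[of n] by (auto simp: good_def)
      ultimately have ends: "3/5 \<le> u + real i * ?d" "u + real (Suc i) * ?d \<le> 4/5" by linarith+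
      have J: "u + real i * ?d + ?d = u + real (Suc i) * ?d" by (simp add: algebra_simps)
      have "free h (?J i) ?d" if "i \<notin> bad h" for h
        using that i unfolding bad_def free_def e_def by blast
      hence "good (Suc n) (u + real i * ?d)" if "i \<notin> bad id \<union> bad f"
        using that ends unfolding good_def J by blast
      thus "i \<in> ?G \<union> (bad id \<union> bad f)" using i by blast
    qed
    hence "card {..<N} \<le> card (?G \<union> (bad id \<union> bad f))" using fin by (intro card_mono) auto
    also have "\<dots> \<le> card ?G + (card (bad id) + card (bad f))"
      by (rule order_trans[OF card_Un_le]) (intro add_left_mono card_Un_le)
    finally have "real N \<le> real (card ?G) + (real (card (bad id)) + real (card (bad f)))"
      unfolding card_lessThan of_nat_add[symmetric] by (rule of_nat_mono)
    thus ?thesis using b by simp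
  qed
  fix V :: "nat \<Rightarrow> (real \<times> real) set" and r
  assume r: "\<And>i. 0 < r i" and V: "\<And>i x y. x \<in> V i \<Longrightarrow> y \<in> V i \<Longrightarrow> dist x y \<le> r i"
    and q: "summable (\<lambda>i. r i powr (1 - 5 / real m))" "(\<Sum>i. r i powr (1 - 5 / real m)) \<le> (L / real N) powr s"
  have "\<exists>x. (\<forall>n. \<exists>u. good n u \<and> u \<le> x \<and> x \<le> u + L / real N ^ n) \<and> (\<forall>i. x \<notin> fst ` V i)"
  proof (rule nested_intervals_escape[where good = good and ?u0.0 = "3/5", OF _ N(1) s Ns root])
    show "\<bar>x - y\<bar> \<le> r i" if xy: "x \<in> fst ` V i" "y \<in> fst ` V i" for i x y
    proof -
      obtain p p' where p: "p \<in> V i" "p' \<in> V i" "x = fst p" "y = fst p'" using xy by blast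
      have "\<bar>x - y\<bar> \<le> dist p p'" using dist_fst_le[of p p'] by (simp add: p dist_real_def)
      thus ?thesis using V[OF p(1,2)] by simp
    qed
  qed (use children r q in \<open>simp_all add: \<rho>_def s_def L_def\<close>)
  then obtain x where x: "\<And>n. \<exists>u. good n u \<and> u \<le> x \<and> x \<le> u + \<rho> n" and xV: "\<And>i. x \<notin> fst ` V i"
    unfolding \<rho>_def by blast
  have x01: "3/5 \<le> x" "x \<le> 4/5" using x[of 0] by (auto simp: good_def)
  have avoid: "(1 - 2 * l) * l ^ k / 2 \<le> \<bar>h x - p\<bar>" if h: "h = id \<or> h = f" and p: "p \<in> gap_centres l k" for h k p
  proof (rule ccontr)
    assume "\<not> ?thesis"
    hence hit: "meets_gap l h k J" if "x \<in> J" for J using p that by (auto simp: meets_gap_def not_le)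
    have "1 < real N" using m by (simp add: N_def)
    hence "(\<lambda>n. L / 32 * inverse (real N) ^ n) \<longlonglongrightarrow> L / 32 * 0"
      by (intro tendsto_intros LIMSEQ_power_zero) (auto simp: inverse_less_1_iff)
    hence "\<forall>\<^sub>F n in sequentially. L / 32 * inverse (real N) ^ n < e * l ^ k"
      by (rule order_tendstoD) (use e l in simp)
    then obtain n where "L / 32 * inverse (real N) ^ n < e * l ^ k" unfolding eventually_sequentially by blast
    hence n: "\<rho> n / 32 \<le> e * l ^ k" by (simp add: \<rho>_def field_simps)
    obtain u where "good n u" "x \<in> {u..u + \<rho> n}" using x[of n] by auto
    thus False using n hit h by (auto simp: good_def free_def)
  qed
  have "x \<in> cantor_set l"
    by (rule mem_cantor_set_if_avoids_gaps[OF l]) (use x01 avoid[of id] in auto)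
  moreover have "f x \<in> cantor_set l"
  proof (rule mem_cantor_set_if_avoids_gaps[OF l])
    have "0 \<le> x\<^sup>2" "x\<^sup>2 \<le> 1" using x01 by (auto simp: power_le_one)
    thus "0 \<le> f x" "f x \<le> 1" by (auto simp: f_def)
  qed (use avoid[of f] in auto)
  moreover have "x\<^sup>2 + (f x)\<^sup>2 = 1" using x01 by (simp add: f_def power_le_one)
  ultimately have "(x, f x) \<in> cantor_circle l" by (simp add: cantor_circle_def)
  thus "\<exists>p\<in>cantor_circle l. \<forall>i. p \<notin> V i" using xV by force
qed

section \<open>Asymptotics as the ratio tends to one half\<close>

theorem theorem5p7:
  shows "ereal (1 / ln 2)
           \<le> Liminf (at_left (1/2 :: real)) (\<lambda>l. (1 - hausdorff_dim (cantor_circle l)) / ereal (1 - 2 * l))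
       \<and> Liminf (at_left (1/2 :: real)) (\<lambda>l. (1 - hausdorff_dim (cantor_circle l)) / ereal (1 - 2 * l))
           \<le> Limsup (at_left (1/2 :: real)) (\<lambda>l. (1 - hausdorff_dim (cantor_circle l)) / ereal (1 - 2 * l))
       \<and> Limsup (at_left (1/2 :: real)) (\<lambda>l. (1 - hausdorff_dim (cantor_circle l)) / ereal (1 - 2 * l))
           \<le> ereal (1536 * (1 + 3 * sqrt 39 / (5 * sqrt 7)))"
proof (intro conjI)
  let ?F = "at_left (1/2 :: real)"
  let ?q = "\<lambda>l. (1 - hausdorff_dim (cantor_circle l)) / ereal (1 - 2 * l)"
  have near: "\<forall>\<^sub>F l in ?F. b < l \<and> l < 1/2" if "b < 1/2" for b :: real
    using eventually_at_left_real[OF that] by (simp add: greaterThanLessThan_iff)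
  have lower: "\<forall>\<^sub>F l in ?F. ereal (1 / ln (1 / l)) \<le> ?q l"
    using near[of 0, simplified]
  proof eventually_elim
    case (elim l)
    hence l: "0 < l" "l < 1/2" by auto
    define e where "e = 1 - 2 * l"
    have e: "0 < e" using l by (simp add: e_def)
    have lnl: "0 < ln (1 / l)" using l by (simp add: field_simps)
    have "ln (2 * l) \<le> 2 * l - 1" using l by (intro ln_le_minus_one) auto
    hence "e \<le> ln (1 / l) - ln 2" using l by (simp add: e_def ln_mult ln_div)
    hence "e / ln (1 / l) \<le> 1 - ln 2 / ln (1 / l)" using lnl by (simp add: field_simps)
    hence "1 / ln (1 / l) \<le> (1 - ln 2 / ln (1 / l)) / e" using e lnl by (simp add: field_simps)
    hence "ereal (1 / ln (1 / l)) \<le> ereal (1 - ln 2 / ln (1 / l)) / ereal e" using e by simp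
    also have "ereal (1 - ln 2 / ln (1 / l)) \<le> 1 - hausdorff_dim (cantor_circle l)"
      using ereal_minus_mono[OF order_refl hausdorff_dim_cantor_circle_le[OF l], of 1]
      by (simp add: one_ereal_def)
    hence "ereal (1 - ln 2 / ln (1 / l)) / ereal e \<le> ?q l"
      unfolding e_def[symmetric] using e by (intro ereal_divide_right_mono) auto
    finally show ?case .
  qed
  have "((\<lambda>l. 1 / ln (1 / l)) \<longlongrightarrow> 1 / ln (1 / (1/2))) ?F"
    by (intro tendsto_intros) auto
  hence lim: "((\<lambda>l. ereal (1 / ln (1 / l))) \<longlongrightarrow> ereal (1 / ln 2)) ?F"
    by simp
  have "ereal (1 / ln 2) = Liminf ?F (\<lambda>l. ereal (1 / ln (1 / l)))"
    by (rule lim_imp_Liminf[OF _ lim, symmetric]) simp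
  also have "\<dots> \<le> Liminf ?F ?q" by (rule Liminf_mono[OF lower])
  finally show "ereal (1 / ln 2) \<le> Liminf ?F ?q" .
  show "Liminf ?F ?q \<le> Limsup ?F ?q" by (rule Liminf_le_Limsup) simp
  have "\<forall>\<^sub>F l in ?F. ?q l \<le> ereal 3000"
    using near[of "1/2 - 1/12000", simplified]
  proof eventually_elim
    case (elim l)
    hence l: "0 < l" "l < 1/2" by auto
    define e where "e = 1 - 2 * l"
    have e: "0 < e" "6000 * e < 1" using elim by (auto simp: e_def)
    \<comment> \<open>the largest \<open>m\<close> that \<open>hausdorff_dim_cantor_circle_ge\<close> admits\<close>
    define m where "m = nat \<lfloor>1 / (400 * e)\<rfloor>"
    have "0 \<le> 1 / (400 * e)" using e by simp
    hence m: "real m \<le> 1 / (400 * e)" "1 / (400 * e) < real m + 1"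
      unfolding m_def by linarith+
    have up: "real m * e \<le> 1/400" using m(1) e by (simp add: field_simps)
    have "1/400 < (real m + 1) * e" using m(2) e by (simp add: field_simps)
    hence "1/400 < real m * e + e" by (simp add: algebra_simps)
    hence low: "1/600 \<le> real m * e" using e by simp
    have "12 \<le> m"
    proof (rule ccontr)
      assume "\<not> 12 \<le> m"
      hence "(real m + 1) * e \<le> 12 * e" using e by (intro mult_right_mono) auto
      with \<open>1/400 < (real m + 1) * e\<close> have "1/400 < 12 * e" by (rule order.strict_trans2)
      thus False using e by simp
    qed
    hence "ereal (1 - 5 / real m) \<le> hausdorff_dim (cantor_circle l)"
      using hausdorff_dim_cantor_circle_ge[OF l, of m] up by (simp add: e_def)
    hence "1 - hausdorff_dim (cantor_circle l) \<le> ereal (5 / real m)"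
      using ereal_minus_mono[OF order_refl, of _ _ 1] by (fastforce simp: one_ereal_def)
    hence "?q l \<le> ereal (5 / real m) / ereal e"
      unfolding e_def[symmetric] using e by (intro ereal_divide_right_mono) auto
    also have "\<dots> = ereal (5 / (real m * e))" using e by simp
    also have "\<dots> \<le> ereal 3000"
    proof -
      have "5 \<le> 3000 * (real m * e)" "0 < real m * e" using low by linarith+
      thus ?thesis by (simp only: ereal_less_eq pos_divide_le_eq)
    qed
    finally show ?case .
  qed
  hence bound: "Limsup ?F ?q \<le> ereal 3000" by (rule Limsup_bounded)
  define c :: real where "c = 3 * sqrt 39 / (5 * sqrt 7)"
  have "(5 * sqrt 7 :: real) \<le> 3 * sqrt 39"
    by (rule power2_le_imp_le) (simp_all add: power_mult_distrib)
  hence "1 \<le> c" by (simp add: c_def)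
  hence "ereal 3000 \<le> ereal (1536 * (1 + c))" by simp
  with bound have "Limsup ?F ?q \<le> ereal (1536 * (1 + c))" by (rule order_trans)
  thus "Limsup ?F ?q \<le> ereal (1536 * (1 + 3 * sqrt 39 / (5 * sqrt 7)))"
    by (simp only: c_def)
qed

end
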